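(* Let $(X,Y,P)$ be an optimal solution of the semidefinite program $$\min_{X,Y,P}\ \operatorname{Tr}(QX)+\operatorname{Tr}(P)\quad\text{s.t.}\quad \begin{bmatrix}P & R^{1/2}Y\\ (R^{1/2}Y)^{\top} & X\end{bmatrix}\succeq0,\qquad \begin{bmatrix}X-W & AX+BY\\ (AX+BY)^{\top} & X\end{bmatrix}\succeq0,$$ over $X\in\mathbb{R}^{n\times n}$ symmetric, $Y\in\mathbb{R}^{m\times n}$ and an auxiliary positive semidefinite matrix $P\in\mathbb{R}^{m\times m}$. Then $K_{\mathrm{lqr}}:=YX^{-1}$ is an optimal unconstrained feedback gain, i.e. it is strictly stabilizing for $(A,B)$ and minimizes the stationary cost $\mathbf{E}[x^{\top}Qx+u^{\top}Ru]$ among all strictly stabilizing feedback gains $K\in\mathbb{R}^{m\times n}$. Moreover, $X$ is exactly the stationary covariance of the state under this feedback, $X=\bar X(K_{\mathrm{lqr}})$.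
   Context: Consider the discrete-time linear system $x_{t+1}=Ax_t+Bu_t+w_t$ with $A\in\mathbb{R}^{n\times n}$, $B\in\mathbb{R}^{n\times m}$, $(A,B)$ stabilizable, fixed initial condition $x_0\in\mathbb{R}^n$, and state feedback $u_t=Kx_t$. The disturbances $\{w_t\}$ are a white noise process with zero mean and common finite covariance $W=\mathbf{E}[w_tw_t^{\top}]\succ0$. $Q\in\mathbb{R}^{n\times n}$ and $R\in\mathbb{R}^{m\times m}$ are positive definite weighting matrices, and $R^{1/2}$ is the positive definite square root of $R$. $K$ is strictly stabilizing if all eigenvalues of $A+BK$ have modulus less than $1$; then $\bar X(K)\succ0$ denotes the unique solution of $\bar X-(A+BK)\bar X(A+BK)^{\top}-W=0$. The stationary state $x$ under the gain $K$ is a random variable with mean $0$ and covariance $\bar X(K)$, and the stationary input is $u:=Kx$. "Unconstrained" means that no chance constraints on $x$ or $u$ are imposed. $\succeq$ denotes the semidefinite ordering on symmetric matrices. *)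

theory Defs
  imports "HOL-Probability.Probability"
begin

definition psd :: "real^'n^'n \<Rightarrow> bool" where
  "psd M \<longleftrightarrow> transpose M = M \<and> (\<forall>v. 0 \<le> v \<bullet> (M *v v))"

definition posdef :: "real^'n^'n \<Rightarrow> bool" where
  "posdef M \<longleftrightarrow> transpose M = M \<and> (\<forall>v. v \<noteq> 0 \<longrightarrow> 0 < v \<bullet> (M *v v))"

(* Only meaningful for positive definite R, where the root exists and is unique. *)
definition posdef_sqrt :: "real^'n^'n \<Rightarrow> real^'n^'n" where
  "posdef_sqrt R = (THE S. posdef S \<and> S ** S = R)"

definition block_matrix ::
  "real^'p^'p \<Rightarrow> real^'q^'p \<Rightarrow> real^'p^'q \<Rightarrow> real^'q^'q \<Rightarrow> real^('p + 'q)^('p + 'q)" where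
  "block_matrix M11 M12 M21 M22 = (\<chi> i j.
     case i of
       Inl a \<Rightarrow> (case j of Inl b \<Rightarrow> M11 $ a $ b | Inr b \<Rightarrow> M12 $ a $ b)
     | Inr a \<Rightarrow> (case j of Inl b \<Rightarrow> M21 $ a $ b | Inr b \<Rightarrow> M22 $ a $ b))"

(* Eigenvalues of a real matrix are taken over the complex numbers. *)
definition eigenvalues :: "real^'n^'n \<Rightarrow> complex set" where
  "eigenvalues M = {\<mu>. \<exists>v. v \<noteq> 0 \<and> map_matrix complex_of_real M *v v = \<mu> *s v}"

(* Under u = K x the dynamics x' = A x + B u + w read x' = (A + B K) x + w. *)
definition closed_loop :: "real^'n^'n \<Rightarrow> real^'m^'n \<Rightarrow> real^'n^'m \<Rightarrow> real^'n^'n" where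
  "closed_loop A B K = A + B ** K"

definition strictly_stabilizing :: "real^'n^'n \<Rightarrow> real^'m^'n \<Rightarrow> real^'n^'m \<Rightarrow> bool" where
  "strictly_stabilizing A B K \<longleftrightarrow> (\<forall>\<mu> \<in> eigenvalues (closed_loop A B K). cmod \<mu> < 1)"

definition stabilizable :: "real^'n^'n \<Rightarrow> real^'m^'n \<Rightarrow> bool" where
  "stabilizable A B \<longleftrightarrow> (\<exists>K. strictly_stabilizing A B K)"

(* Only meaningful for strictly stabilizing K, where the solution exists and is unique. *)
definition stationary_cov ::
  "real^'n^'n \<Rightarrow> real^'m^'n \<Rightarrow> real^'n^'n \<Rightarrow> real^'n^'m \<Rightarrow> real^'n^'n" where
  "stationary_cov A B W K =
     (THE X. X - closed_loop A B K ** X ** transpose (closed_loop A B K) - W = 0)"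

definition second_order :: "'w measure \<Rightarrow> ('w \<Rightarrow> real^'n) \<Rightarrow> bool" where
  "second_order M x \<longleftrightarrow> x \<in> borel_measurable M \<and> integrable M (\<lambda>\<omega>. (norm (x \<omega>))\<^sup>2)"

(* The matrix E[x y^T]. *)
definition cross_moment ::
  "'w measure \<Rightarrow> ('w \<Rightarrow> real^'n) \<Rightarrow> ('w \<Rightarrow> real^'p) \<Rightarrow> real^'p^'n" where
  "cross_moment M x y = (\<chi> i j. \<integral>\<omega>. x \<omega> $ i * y \<omega> $ j \<partial>M)"

definition covariance :: "'w measure \<Rightarrow> ('w \<Rightarrow> real^'n) \<Rightarrow> real^'n^'n" where
  "covariance M x =
     cross_moment M (\<lambda>\<omega>. x \<omega> - integral\<^sup>L M x) (\<lambda>\<omega>. x \<omega> - integral\<^sup>L M x)"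

(* White noise in the second-order sense: different times are uncorrelated,
   not necessarily independent or identically distributed. *)
definition white_noise ::
  "'w measure \<Rightarrow> (nat \<Rightarrow> 'w \<Rightarrow> real^'n) \<Rightarrow> real^'n^'n \<Rightarrow> bool" where
  "white_noise M w W \<longleftrightarrow>
     (\<forall>t. second_order M (w t) \<and> integral\<^sup>L M (w t) = 0 \<and> cross_moment M (w t) (w t) = W) \<and>
     (\<forall>s t. s \<noteq> t \<longrightarrow> cross_moment M (w s) (w t) = 0)"

definition stationary_state ::
  "'w measure \<Rightarrow> real^'n^'n \<Rightarrow> real^'m^'n \<Rightarrow> real^'n^'n \<Rightarrow> real^'n^'m \<Rightarrow> ('w \<Rightarrow> real^'n) \<Rightarrow> bool" where
  "stationary_state M A B W K x \<longleftrightarrow>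
     second_order M x \<and> integral\<^sup>L M x = 0 \<and> covariance M x = stationary_cov A B W K"

definition expected_cost ::
  "'w measure \<Rightarrow> real^'n^'n \<Rightarrow> real^'m^'m \<Rightarrow> ('w \<Rightarrow> real^'n) \<Rightarrow> ('w \<Rightarrow> real^'m) \<Rightarrow> real" where
  "expected_cost M Q R x u = (\<integral>\<omega>. x \<omega> \<bullet> (Q *v x \<omega>) + u \<omega> \<bullet> (R *v u \<omega>) \<partial>M)"

(* The cost of a gain is evaluated at an arbitrary stationary state, since it only depends on the
   covariance.  If M carries white noise w with covariance W > 0, then stationary states exist
   for every strictly stabilizing K: take a suitable linear image of w 0. *)
definition optimal_unconstrained_gain ::
  "'w measure \<Rightarrow> real^'n^'n \<Rightarrow> real^'m^'n \<Rightarrow> real^'n^'n \<Rightarrow> real^'n^'n \<Rightarrow> real^'m^'m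
     \<Rightarrow> real^'n^'m \<Rightarrow> bool" where
  "optimal_unconstrained_gain M A B W Q R K \<longleftrightarrow>
     strictly_stabilizing A B K \<and>
     (\<forall>K' x x'. strictly_stabilizing A B K' \<longrightarrow>
        stationary_state M A B W K x \<longrightarrow> stationary_state M A B W K' x' \<longrightarrow>
        expected_cost M Q R x (\<lambda>\<omega>. K *v x \<omega>) \<le> expected_cost M Q R x' (\<lambda>\<omega>. K' *v x' \<omega>))"

definition sdp_feasible ::
  "real^'n^'n \<Rightarrow> real^'m^'n \<Rightarrow> real^'n^'n \<Rightarrow> real^'m^'m
     \<Rightarrow> real^'n^'n \<Rightarrow> real^'n^'m \<Rightarrow> real^'m^'m \<Rightarrow> bool" where
  "sdp_feasible A B W R X Y P \<longleftrightarrow>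
     transpose X = X \<and> psd P \<and>
     psd (block_matrix P (posdef_sqrt R ** Y) (transpose (posdef_sqrt R ** Y)) X) \<and>
     psd (block_matrix (X - W) (A ** X + B ** Y) (transpose (A ** X + B ** Y)) X)"

definition sdp_optimal ::
  "real^'n^'n \<Rightarrow> real^'m^'n \<Rightarrow> real^'n^'n \<Rightarrow> real^'n^'n \<Rightarrow> real^'m^'m
     \<Rightarrow> real^'n^'n \<Rightarrow> real^'n^'m \<Rightarrow> real^'m^'m \<Rightarrow> bool" where
  "sdp_optimal A B W Q R X Y P \<longleftrightarrow>
     is_arg_min (\<lambda>(X, Y, P). trace (Q ** X) + trace P)
       (\<lambda>(X, Y, P). sdp_feasible A B W R X Y P) (X, Y, P)"

end

theory Submission
  imports Defs "HOL-Complex_Analysis.Complex_Analysis"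
begin

text \<open>
  Write \<open>K = Y X\<inverse>\<close>, \<open>F = A + B K\<close> and \<open>L = R\<^sup>1\<^sup>/\<^sup>2 K\<close>, so that
  \<open>Y = K X\<close>.  The second block constraint forces \<open>X \<succeq> W \<succ> 0\<close>, and in terms of \<open>K\<close> the two
  constraints are the Schur complement conditions \<open>P \<succeq> L X L\<^sup>T\<close> and
  \<open>X \<succeq> F X F\<^sup>T + W\<close> (\<open>sdp_feasible_iff\<close>).  The program is therefore a relaxation of the LQR problem in
  which the covariance equation \<open>X = F X F\<^sup>T + W\<close> has become an inequality: every strictly
  stabilizing gain, together with its stationary covariance, is a feasible point whose objective
  value is the stationary cost of the gain (\<open>stabilizing_gain_sdp_feasible\<close>,
  \<open>expected_cost_eq_gain_cost\<close>).

  The relaxation is tight.  The Lyapunov inequality with \<open>W \<succ> 0\<close> makes \<open>F\<close> stable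
  (\<open>lyapunov_schur_stable\<close>), so \<open>K\<close> has a stationary covariance \<open>X\<^sub>0\<close>.  The difference
  \<open>D = X - X\<^sub>0\<close> satisfies \<open>D \<succeq> F D F\<^sup>T\<close>, and iterating this inequality gives
  \<open>D \<succeq> F\<^sup>k D (F\<^sup>T)\<^sup>k \<longlonglongrightarrow> 0\<close> (\<open>stein_inequality_psd\<close>).  Replacing \<open>X\<close> by \<open>X\<^sub>0\<close>
  and \<open>P\<close> by \<open>L X\<^sub>0 L\<^sup>T\<close> thus lowers the objective by at least \<open>Tr (Q D)\<close>.
  Optimality yields \<open>Tr (Q D) \<le> 0\<close>, and \<open>Q \<succ> 0\<close> then
  forces \<open>D = 0\<close> (\<open>trace_posdef_psd\<close>).  Hence \<open>X = X\<^sub>0\<close>, the cost of \<open>K\<close> is at most the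
  optimal value, and that value is a lower bound for the cost of every stabilizing gain.

  Two classical facts carry the argument.  The positive definite square root exists and is unique
  (\<open>posdef_square_root_exists\<close>, \<open>posdef_square_root_unique\<close>), which gives meaning to
  \<open>R\<^sup>1\<^sup>/\<^sup>2\<close>.  A matrix with spectrum in the open unit disc has powers tending to zero
  (\<open>schur_stable_powers_tendsto_0\<close>), which gives existence, uniqueness and positivity of the
  solution of the covariance equation.
\<close>

(* Keeps the dollar sign for vector components only. *)
no_notation fps_nth (infixl "$" 75)

section \<open>Quadratic forms and traces\<close>

lemma inner_transpose_mult:
  fixes L :: "real^'n^'m"
  shows "u \<bullet> (transpose L *v v) = (L *v u) \<bullet> v"
  by (metis dot_lmul_matrix inner_commute transpose_matrix_vector)

lemma matrix_eq_inner:
  fixes M N :: "real^'n^'m"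
  assumes "\<And>u v. u \<bullet> (M *v v) = u \<bullet> (N *v v)"
  shows "M = N"
  by (metis assms matrix_eq vector_eq_rdot inner_commute)

lemma symmetric_inner:
  fixes M :: "real^'n^'n"
  assumes "transpose M = M"
  shows "u \<bullet> (M *v v) = (M *v u) \<bullet> v"
  by (metis assms inner_transpose_mult)

lemma symmetricI:
  fixes M :: "real^'n^'n"
  assumes "\<And>u v. u \<bullet> (M *v v) = (M *v u) \<bullet> v"
  shows "transpose M = M"
  by (rule matrix_eq_inner) (simp add: assms inner_transpose_mult del: transpose_matrix_vector)

lemma matrix_diff_ldistrib:
  fixes A :: "real^'n^'m" and B C :: "real^'p^'n"
  shows "A ** (B - C) = A ** B - A ** C"
  by (simp add: matrix_matrix_mult_def vec_eq_iff right_diff_distrib sum_subtractf)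

lemma matrix_diff_rdistrib:
  fixes A B :: "real^'n^'m" and C :: "real^'p^'n"
  shows "(A - B) ** C = A ** C - B ** C"
  by (simp add: matrix_matrix_mult_def vec_eq_iff left_diff_distrib sum_subtractf)

lemma matrix_add_rdistrib:
  fixes A B :: "real^'n^'m" and C :: "real^'p^'n"
  shows "(A + B) ** C = A ** C + B ** C"
  by (simp add: matrix_matrix_mult_def vec_eq_iff distrib_right sum.distrib)

lemma transpose_diff:
  fixes A B :: "real^'n^'m"
  shows "transpose (A - B) = transpose A - transpose B"
  by (simp add: transpose_def vec_eq_iff)

lemma nonneg_quadratic_linear_coeff_0:
  fixes b c :: real
  assumes "\<And>t. 0 \<le> 2 * t * b + t\<^sup>2 * c"
  shows "b = 0"
proof (rule ccontr)
  assume "b \<noteq> 0"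
  define d where "d = \<bar>c\<bar> + 1"
  have d: "d > 0" "c < 2 * d" by (auto simp: d_def)
  \<comment> \<open>A step against the slope, short enough (\<open>d > \<bar>c\<bar>\<close>) for the linear term to dominate.\<close>
  have "0 \<le> 2 * (- b / d) * b + (- b / d)\<^sup>2 * c" by (rule assms)
  also have "\<dots> = b\<^sup>2 / d\<^sup>2 * (c - 2 * d)"
    using d by (simp add: field_simps power2_eq_square)
  also have "\<dots> < 0"
    using d \<open>b \<noteq> 0\<close> by (intro mult_pos_neg) auto
  finally show False by simp
qed

text \<open>First-order condition at a minimum of the form: along the line \<open>v + t w\<close> the form is a quadratic
  in \<open>t\<close> that vanishes at \<open>0\<close> and stays nonnegative, so its linear coefficient is \<open>0\<close>.  Positivity is
  assumed on this one line only, so that the lemma applies to forms that are nonnegative merely on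
  an invariant subspace.\<close>

lemma symmetric_form_minimum_orthogonal:
  fixes M :: "real^'n^'n"
  assumes sym: "transpose M = M"
    and nonneg: "\<And>t. 0 \<le> (v + t *\<^sub>R w) \<bullet> (M *v (v + t *\<^sub>R w))"
    and null: "v \<bullet> (M *v v) = 0"
  shows "w \<bullet> (M *v v) = 0"
proof -
  have "0 \<le> 2 * t * (w \<bullet> (M *v v)) + t\<^sup>2 * (w \<bullet> (M *v w))" for t
  proof -
    have "v \<bullet> (M *v w) = w \<bullet> (M *v v)"
      using symmetric_inner[OF sym, of v w] by (simp add: inner_commute)
    then show ?thesis
      using nonneg[of t] null
      by (simp add: matrix_vector_right_distrib matrix_vector_mult_scaleR inner_add_left
          inner_add_right power2_eq_square algebra_simps)
  qed
  then show ?thesis by (rule nonneg_quadratic_linear_coeff_0)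
qed

lemma psd_null_vector:
  fixes M :: "real^'n^'n"
  assumes "psd M" and "v \<bullet> (M *v v) = 0"
  shows "M *v v = 0"
proof -
  have "(M *v v) \<bullet> (M *v v) = 0"
    by (rule symmetric_form_minimum_orthogonal) (use assms in \<open>auto simp: psd_def\<close>)
  then show ?thesis by simp
qed

lemma psd_0: "psd 0"
  by (simp add: psd_def transpose_def vec_eq_iff)

lemma posdef_imp_psd: "posdef M \<Longrightarrow> psd M"
  unfolding posdef_def psd_def by (metis inner_zero_left less_imp_le order_refl)

lemma posdef_null_vector:
  fixes M :: "real^'n^'n"
  assumes "posdef M" and "M *v v = 0"
  shows "v = 0"
  using assms unfolding posdef_def by (metis inner_zero_right less_irrefl)

lemma posdef_mult_eq_0:
  fixes M :: "real^'n^'n" and D :: "real^'m^'n"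
  assumes "posdef M" and "M ** D = 0"
  shows "D = 0"
proof -
  have "M *v (D *v v) = 0" for v
    by (simp add: matrix_vector_mul_assoc assms(2))
  then show ?thesis
    using posdef_null_vector[OF assms(1)] by (simp add: matrix_eq)
qed

lemma psd_dominates_posdef:
  assumes "psd (X - W)" and "posdef W"
  shows "posdef X"
  unfolding posdef_def
proof (intro conjI allI impI)
  have "transpose (X - W) = X - W" "transpose W = W"
    using assms by (auto simp: psd_def posdef_def)
  then show "transpose X = X" by (simp add: transpose_diff)
  fix v :: "real^'a" assume "v \<noteq> 0"
  then have "0 \<le> v \<bullet> ((X - W) *v v)" "0 < v \<bullet> (W *v v)"
    using assms by (auto simp: psd_def posdef_def)
  then show "0 < v \<bullet> (X *v v)" by (simp add: matrix_vector_mult_diff_rdistrib inner_diff_right)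
qed

lemma posdef_matrix_inv:
  assumes "posdef X"
  shows "matrix_inv X ** X = mat 1"
proof -
  have "invertible X"
    unfolding invertible_left_inverse matrix_left_invertible_ker
    using posdef_null_vector[OF assms] by blast
  then show ?thesis
    unfolding invertible_def matrix_inv_def by (rule someI2_ex) simp
qed

lemma form_congruence:
  fixes M :: "real^'n^'n" and L :: "real^'n^'m"
  shows "u \<bullet> ((L ** M ** transpose L) *v v) = (transpose L *v u) \<bullet> (M *v (transpose L *v v))"
  by (metis inner_transpose_mult matrix_vector_mul_assoc transpose_transpose)

lemma psd_congruence:
  fixes M :: "real^'n^'n" and L :: "real^'n^'m"
  assumes "psd M"
  shows "psd (L ** M ** transpose L)"
  using assms by (simp add: psd_def form_congruence matrix_transpose_mul matrix_mul_assoc)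

text \<open>Reading a trace as a sum of values of the form turns positivity of matrices into positivity of
  traces.\<close>

lemma trace_eq_sum_form:
  fixes M :: "real^'n^'n"
  shows "trace M = (\<Sum>i\<in>UNIV. axis i 1 \<bullet> (M *v axis i 1))"
  by (simp add: trace_def inner_axis' matrix_vector_mul_component inner_axis)

lemma trace_psd_nonneg:
  assumes "psd M"
  shows "0 \<le> trace M"
  using assms by (simp add: trace_eq_sum_form psd_def sum_nonneg)

text \<open>The trace is the sum of \<open>z \<bullet> M z\<close> over the columns \<open>z\<close> of \<open>L\<^sup>T\<close>; as all terms are nonnegative,
  each of them vanishes, and null vectors of a semidefinite form lie in the kernel.\<close>

lemma trace_congruence_eq_0:
  fixes M :: "real^'n^'n" and L :: "real^'n^'m"
  assumes M: "psd M" and tr: "trace (L ** M ** transpose L) = 0"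
  shows "M ** transpose L = 0"
proof -
  let ?N = "L ** M ** transpose L"
  have N: "psd ?N" by (rule psd_congruence[OF M])
  have "axis i 1 \<bullet> (?N *v axis i 1) = 0" for i
    using tr N unfolding trace_eq_sum_form psd_def
    by (subst (asm) sum_nonneg_eq_0_iff) auto
  then have "M *v (transpose L *v axis i 1) = 0" for i
    by (intro psd_null_vector[OF M]) (simp add: form_congruence del: transpose_matrix_vector)
  then have "(M ** transpose L) *v axis i 1 = 0" for i
    by (simp add: matrix_vector_mul_assoc del: transpose_matrix_vector)
  then have "column i (M ** transpose L) = 0" for i
    by (metis matrix_vector_mult_basis)
  then show ?thesis by (simp add: vec_eq_iff column_def)
qed

section \<open>The positive definite square root\<close>

text \<open>
  The spectral theorem, by induction on the dimension of an invariant subspace.  A maximizer \<open>v\<close> of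
  the Rayleigh quotient on \<open>V\<close>, with maximum \<open>l\<close>, is a null vector of \<open>l I - M\<close>, whose form is
  nonnegative on \<open>V\<close>; the first-order condition makes it an eigenvector.  By symmetry of \<open>M\<close> the
  orthogonal complement of \<open>v\<close> in \<open>V\<close> is again invariant.
\<close>

lemma symmetric_eigenbasis:
  fixes M :: "real^'n^'n"
  assumes sym: "transpose M = M"
  shows "subspace V \<Longrightarrow> (\<And>v. v \<in> V \<Longrightarrow> M *v v \<in> V) \<Longrightarrow>
    \<exists>E. finite E \<and> E \<subseteq> V \<and> span E = V \<and> pairwise orthogonal E \<and>
      (\<forall>e\<in>E. norm e = 1 \<and> (\<exists>l. M *v e = l *\<^sub>R e))"
proof (induction "dim V" arbitrary: V rule: less_induct)
  case less
  note V = less.prems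
  show ?case
  proof (cases "V = {0}")
    case True
    then show ?thesis by (intro exI[of _ "{}"]) auto
  next
    case False
    let ?q = "\<lambda>v. v \<bullet> (M *v v)"
    obtain u where u: "u \<in> V" "u \<noteq> 0"
      using False subspace_0[OF V(1)] by blast
    have "u /\<^sub>R norm u \<in> V \<inter> sphere 0 1"
      using u by (simp add: subspace_scale[OF V(1)])
    then have "V \<inter> sphere 0 1 \<noteq> {}" by blast
    moreover have "compact (V \<inter> sphere 0 1)"
      by (intro closed_Int_compact closed_subspace V compact_sphere)
    moreover have "continuous_on (V \<inter> sphere 0 1) ?q"
      by (intro continuous_intros linear_continuous_on matrix_vector_mul_bounded_linear)
    ultimately obtain v where "v \<in> V \<inter> sphere 0 1"
      and "\<forall>u\<in>V \<inter> sphere 0 1. ?q u \<le> ?q v"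
      using continuous_attains_sup[of "V \<inter> sphere 0 1" ?q] by blast
    then have v: "v \<in> V" "norm v = 1"
      and max: "\<And>u. u \<in> V \<Longrightarrow> norm u = 1 \<Longrightarrow> ?q u \<le> ?q v"
      by auto
    define l where "l = ?q v"
    have rayleigh: "?q u \<le> l * (u \<bullet> u)" if "u \<in> V" for u
    proof (cases "u = 0")
      case nz: False
      have "?q (u /\<^sub>R norm u) \<le> l"
        unfolding l_def using that nz by (intro max) (auto simp: subspace_scale[OF V(1)])
      then show ?thesis
        using nz by (simp add: matrix_vector_mult_scaleR dot_square_norm field_simps power2_eq_square)
    qed simp
    define N where "N = l *\<^sub>R mat 1 - M"
    have N_apply: "N *v u = l *\<^sub>R u - M *v u" for u
      by (simp add: N_def matrix_vector_mult_diff_rdistrib scaleR_matrix_vector_assoc[symmetric])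
    have symN: "transpose N = N"
      by (rule symmetricI)
        (simp add: N_apply inner_diff_left inner_diff_right symmetric_inner[OF sym])
    have NvV: "N *v v \<in> V"
      unfolding N_apply by (intro subspace_diff subspace_scale V v)
    have "(N *v v) \<bullet> (N *v v) = 0"
    proof (rule symmetric_form_minimum_orthogonal[OF symN])
      fix t
      have "v + t *\<^sub>R (N *v v) \<in> V"
        using NvV by (intro subspace_add subspace_scale V v)
      then show "0 \<le> (v + t *\<^sub>R (N *v v)) \<bullet> (N *v (v + t *\<^sub>R (N *v v)))"
        using rayleigh by (simp add: N_apply inner_diff_right)
    next
      show "v \<bullet> (N *v v) = 0"
        using v by (simp add: N_apply inner_diff_right l_def dot_square_norm)
    qed
    then have eig: "M *v v = l *\<^sub>R v" by (simp add: N_apply)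
    define V' where "V' = {w \<in> V. v \<bullet> w = 0}"
    have V': "subspace V'"
      using V(1) by (auto simp: V'_def subspace_def inner_add_right)
    have "v \<notin> V'" using v by (auto simp: V'_def)
    then have "V' \<subset> V" using v unfolding V'_def by blast
    then have "dim V' < dim V"
      by (intro dim_psubset) (simp add: span_eq_iff[THEN iffD2, OF V'] span_eq_iff[THEN iffD2, OF V(1)])
    moreover have "M *v w \<in> V'" if "w \<in> V'" for w
      using that V(2) symmetric_inner[OF sym, of v w] eig by (auto simp: V'_def)
    ultimately obtain E where E: "finite E" "E \<subseteq> V'" "span E = V'" "pairwise orthogonal E"
      "\<And>e. e \<in> E \<Longrightarrow> norm e = 1 \<and> (\<exists>l. M *v e = l *\<^sub>R e)"
      using less.hyps[of V'] V' by metis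
    show ?thesis
    proof (intro exI[of _ "insert v E"] conjI)
      show "span (insert v E) = V"
      proof
        show "span (insert v E) \<subseteq> V"
          using v E(2) V by (intro span_minimal) (auto simp: V'_def)
        show "V \<subseteq> span (insert v E)"
        proof
          fix x assume x: "x \<in> V"
          have "x - (v \<bullet> x) *\<^sub>R v \<in> V'"
            using x v V by (auto simp: V'_def inner_diff_right dot_square_norm
                intro!: subspace_diff subspace_scale)
          then show "x \<in> span (insert v E)"
            unfolding span_breakdown_eq E(3) by blast
        qed
      qed
      show "pairwise orthogonal (insert v E)"
        using E(2,4) unfolding pairwise_insert
        by (auto simp: V'_def orthogonal_def inner_commute)
    qed (use E v eig in \<open>auto simp: V'_def\<close>)
  qed
qed

text \<open>On an orthonormal eigenbasis of \<open>R\<close>, the square root takes the roots of the eigenvalues.\<close>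

lemma posdef_square_root_exists:
  fixes R :: "real^'n^'n"
  assumes R: "posdef R"
  shows "\<exists>S. posdef S \<and> S ** S = R"
proof -
  have symR: "transpose R = R" using R by (simp add: posdef_def)
  obtain E where E: "finite E" "span E = (UNIV :: (real^'n) set)" "pairwise orthogonal E"
    "\<And>e. e \<in> E \<Longrightarrow> norm e = 1 \<and> (\<exists>l. R *v e = l *\<^sub>R e)"
    using symmetric_eigenbasis[OF symR, of UNIV] by auto
  define l where "l e = e \<bullet> (R *v e)" for e
  have eig: "R *v e = l e *\<^sub>R e" and l: "l e > 0" if "e \<in> E" for e
  proof -
    obtain c where c: "R *v e = c *\<^sub>R e" "norm e = 1" using E(4)[OF \<open>e \<in> E\<close>] by blast
    then show "R *v e = l e *\<^sub>R e" by (simp add: l_def dot_square_norm)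
    have "e \<noteq> 0" using c by auto
    then show "l e > 0" using R by (simp add: l_def posdef_def)
  qed
  define f where "f x = (\<Sum>e\<in>E. (sqrt (l e) * (e \<bullet> x)) *\<^sub>R e)" for x
  define S where "S = matrix f"
  have "linear f"
    unfolding f_def
    by (intro linearI)
      (auto simp: inner_add_right algebra_simps sum.distrib scaleR_sum_right)
  then have S_apply: "S *v x = f x" for x
    unfolding S_def by (metis matrix_vector_mul)
  have inner_S: "y \<bullet> (S *v x) = (\<Sum>e\<in>E. sqrt (l e) * (e \<bullet> x) * (e \<bullet> y))" for x y
    by (simp add: S_apply f_def inner_sum_right inner_commute)
  have "transpose S = S"
    by (rule symmetricI) (simp add: inner_S inner_commute[of "S *v _"] mult_ac)
  moreover have "0 < v \<bullet> (S *v v)" if "v \<noteq> 0" for v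
  proof -
    have "\<exists>e\<in>E. e \<bullet> v \<noteq> 0"
    proof (rule ccontr)
      assume "\<not> (\<exists>e\<in>E. e \<bullet> v \<noteq> 0)"
      then have "\<And>e. e \<in> E \<Longrightarrow> orthogonal v e" by (auto simp: orthogonal_def inner_commute)
      then have "orthogonal v v"
        by (rule orthogonal_to_span[of v E, rotated]) (simp_all add: E(2))
      then show False using that by (simp add: orthogonal_self)
    qed
    then obtain e where e: "e \<in> E" "e \<bullet> v \<noteq> 0" by blast
    show ?thesis unfolding inner_S
    proof (rule sum_pos2[OF E(1) e(1)])
      show "0 < sqrt (l e) * (e \<bullet> v) * (e \<bullet> v)"
        using e l[OF e(1)] by (auto simp: mult.assoc zero_less_mult_iff neq_iff)
      show "0 \<le> sqrt (l i) * (i \<bullet> v) * (i \<bullet> v)" if "i \<in> E" for i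
        using l[OF that] by (simp add: mult.assoc)
    qed
  qed
  ultimately have "posdef S" by (simp add: posdef_def)
  moreover have "S ** S = R"
  proof -
    have Se: "S *v e = sqrt (l e) *\<^sub>R e" if "e \<in> E" for e
    proof -
      have "f e = (\<Sum>d\<in>E. if d = e then sqrt (l e) *\<^sub>R e else 0)"
        unfolding f_def
      proof (intro sum.cong refl)
        fix d assume "d \<in> E"
        then show "(sqrt (l d) * (d \<bullet> e)) *\<^sub>R d = (if d = e then sqrt (l e) *\<^sub>R e else 0)"
          using E(3,4) that by (auto simp: pairwise_def orthogonal_def dot_square_norm)
      qed
      then show ?thesis using that E(1) by (simp add: S_apply)
    qed
    have "(S ** S) *v x = R *v x" for x
    proof (rule linear_eq_on_span[of "(*v) (S ** S)" "(*v) R" E])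
      fix e assume e: "e \<in> E"
      show "(S ** S) *v e = R *v e"
        using l[OF e] by (simp add: matrix_vector_mul_assoc[symmetric] Se[OF e] eig[OF e]
            matrix_vector_mult_scaleR)
    qed (simp_all add: E(2))
    then show ?thesis by (simp add: matrix_eq)
  qed
  ultimately show ?thesis by blast
qed

text \<open>The difference \<open>D = S - T\<close> of two roots satisfies \<open>D S + T D = 0\<close>.  Multiplying by \<open>D\<close> and taking
  traces gives \<open>Tr (D S D) + Tr (D T D) = 0\<close> with both terms nonnegative, so \<open>S D = 0\<close>.\<close>

lemma posdef_square_root_unique:
  fixes S T :: "real^'n^'n"
  assumes S: "posdef S" and T: "posdef T" and eq: "S ** S = T ** T"
  shows "S = T"
proof -
  define D where "D = S - T"
  have symD: "transpose D = D"
    using S T by (simp add: D_def posdef_def transpose_def vec_eq_iff)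
  have "D ** S + T ** D = 0"
    by (simp add: D_def matrix_diff_ldistrib matrix_diff_rdistrib eq)
  then have "trace (D ** (D ** S + T ** D)) = 0" by (simp add: trace_def)
  then have "trace (D ** (D ** S)) + trace (D ** T ** D) = 0"
    by (simp add: matrix_add_ldistrib trace_add matrix_mul_assoc)
  moreover have "trace (D ** (D ** S)) = trace (D ** S ** D)" by (rule trace_mul_sym)
  moreover have "psd (D ** S ** D)" "psd (D ** T ** D)"
    using psd_congruence[OF posdef_imp_psd[OF S], of D] psd_congruence[OF posdef_imp_psd[OF T], of D]
    by (simp_all add: symD)
  ultimately have "trace (D ** S ** transpose D) = 0"
    using trace_psd_nonneg[of "D ** S ** D"] trace_psd_nonneg[of "D ** T ** D"] by (simp add: symD)
  then have "S ** D = 0"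
    using trace_congruence_eq_0[OF posdef_imp_psd[OF S], of D] by (simp add: symD)
  then have "D = 0" by (rule posdef_mult_eq_0[OF S])
  then show ?thesis by (simp add: D_def)
qed

lemma posdef_sqrt:
  assumes "posdef R"
  shows "posdef (posdef_sqrt R)" and "posdef_sqrt R ** posdef_sqrt R = R"
proof -
  have "\<exists>!S. posdef S \<and> S ** S = R"
    using posdef_square_root_exists[OF assms] posdef_square_root_unique by metis
  then have "posdef (posdef_sqrt R) \<and> posdef_sqrt R ** posdef_sqrt R = R"
    unfolding posdef_sqrt_def by (rule theI')
  then show "posdef (posdef_sqrt R)" "posdef_sqrt R ** posdef_sqrt R = R" by auto
qed

text \<open>Cyclicity gives \<open>Tr (Q D) = Tr (S D S)\<close> for the square root \<open>S\<close> of \<open>Q\<close>, the trace of a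
  semidefinite matrix; if it vanishes then so does \<open>D S\<close>, and \<open>S\<close> is invertible.\<close>

lemma trace_posdef_psd:
  fixes Q D :: "real^'n^'n"
  assumes Q: "posdef Q" and D: "psd D"
  shows "0 \<le> trace (Q ** D)" and "trace (Q ** D) = 0 \<Longrightarrow> D = 0"
proof -
  define S where "S = posdef_sqrt Q"
  have S: "posdef S" "S ** S = Q" "transpose S = S"
    using posdef_sqrt[OF Q] by (auto simp: S_def posdef_def)
  have symD: "transpose D = D" using D by (simp add: psd_def)
  have tr: "trace (Q ** D) = trace (S ** D ** transpose S)"
    by (metis S(2,3) matrix_mul_assoc trace_mul_sym)
  show "0 \<le> trace (Q ** D)"
    unfolding tr by (intro trace_psd_nonneg psd_congruence D)
  assume "trace (Q ** D) = 0"
  then have "D ** S = 0"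
    using trace_congruence_eq_0[OF D, of S] by (simp add: tr S(3))
  then have "transpose (D ** S) = 0" by (simp add: transpose_def vec_eq_iff)
  then have "S ** D = 0" by (simp add: matrix_transpose_mul S(3) symD)
  then show "D = 0" by (rule posdef_mult_eq_0[OF S(1)])
qed


section \<open>Spectrum in the open unit disc and vanishing powers\<close>

lemma det_eq_0_iff_kernel:
  fixes M :: "'a::field^'n^'n"
  shows "det M = 0 \<longleftrightarrow> (\<exists>v. v \<noteq> 0 \<and> M *v v = 0)"
  using invertible_det_nz[of M] matrix_left_invertible_ker[of M]
  by (auto simp: invertible_left_inverse)

lemma holomorphic_on_det:
  fixes M :: "complex \<Rightarrow> complex^'n^'n"
  assumes "\<And>i j. (\<lambda>z. M z $ i $ j) holomorphic_on S"
  shows "(\<lambda>z. det (M z)) holomorphic_on S"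
  unfolding det_def by (intro holomorphic_intros assms)

text \<open>This is \<open>I - z F\<close>.  With \<open>z\<close> on this side, the matrix is regular at \<open>0\<close>, stability of \<open>F\<close> becomes
  invertibility on the closed unit disc, and the Taylor coefficients of the inverse are the powers
  of \<open>F\<close>.\<close>

definition resolvent_matrix :: "real^'n^'n \<Rightarrow> complex \<Rightarrow> complex^'n^'n" where
  "resolvent_matrix F z = (\<chi> i j. (if i = j then 1 else 0) - z * complex_of_real (F $ i $ j))"

lemma resolvent_matrix_apply:
  "resolvent_matrix F z *v v = v - z *s (map_matrix complex_of_real F *v v)"
proof -
  have "(\<Sum>j\<in>UNIV. (if i = j then 1 else 0) * v $ j) = v $ i" for i
    by (simp add: if_distrib[of "\<lambda>c. c * _"] cong: if_cong)
  then show ?thesis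
    by (simp add: vec_eq_iff resolvent_matrix_def matrix_vector_mult_def map_matrix_def
      left_diff_distrib sum_subtractf sum_distrib_left mult.assoc)
qed

definition schur_stable :: "real^'n^'n \<Rightarrow> bool" where
  "schur_stable F \<longleftrightarrow> (\<forall>\<mu>\<in>eigenvalues F. cmod \<mu> < 1)"

lemma schur_stable_iff_det:
  "schur_stable F \<longleftrightarrow> (\<forall>z. cmod z \<le> 1 \<longrightarrow> det (resolvent_matrix F z) \<noteq> 0)"
proof
  assume F: "schur_stable F"
  show "\<forall>z. cmod z \<le> 1 \<longrightarrow> det (resolvent_matrix F z) \<noteq> 0"
  proof (intro allI impI notI)
    fix z assume z: "cmod z \<le> 1" and "det (resolvent_matrix F z) = 0"
    then obtain v where v: "v \<noteq> 0" "resolvent_matrix F z *v v = 0"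
      using det_eq_0_iff_kernel[of "resolvent_matrix F z"] by auto
    then have eq: "v = z *s (map_matrix complex_of_real F *v v)"
      by (simp add: resolvent_matrix_apply)
    with v have "z \<noteq> 0" by auto
    have "map_matrix complex_of_real F *v v = inverse z *s (z *s (map_matrix complex_of_real F *v v))"
      using \<open>z \<noteq> 0\<close> by (simp add: vector_smult_assoc)
    then have "map_matrix complex_of_real F *v v = inverse z *s v"
      by (simp only: eq[symmetric])
    then have "inverse z \<in> eigenvalues F"
      using v by (auto simp: eigenvalues_def)
    then have "cmod (inverse z) < 1"
      using F by (simp add: schur_stable_def)
    then show False
      using z \<open>z \<noteq> 0\<close> one_le_inverse[of "cmod z"] by (simp add: norm_inverse)
  qed
next
  assume det: "\<forall>z. cmod z \<le> 1 \<longrightarrow> det (resolvent_matrix F z) \<noteq> 0"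
  show "schur_stable F" unfolding schur_stable_def
  proof (intro ballI, rule ccontr)
    fix \<mu> assume "\<mu> \<in> eigenvalues F" and big: "\<not> cmod \<mu> < 1"
    then obtain v where v: "v \<noteq> 0" "map_matrix complex_of_real F *v v = \<mu> *s v"
      by (auto simp: eigenvalues_def)
    have nz: "\<mu> \<noteq> 0" using big by auto
    have "cmod (inverse \<mu>) \<le> 1"
      unfolding norm_inverse using big by (simp add: inverse_le_1_iff)
    have "resolvent_matrix F (inverse \<mu>) *v v = 0"
      using nz by (simp add: resolvent_matrix_apply v(2) vector_smult_assoc)
    then have "det (resolvent_matrix F (inverse \<mu>)) = 0"
      using det_eq_0_iff_kernel v(1) by blast
    with det \<open>cmod (inverse \<mu>) \<le> 1\<close> show False by blast
  qed
qed

text \<open>Left and right eigenvectors have the same eigenvalues, because both are detected by one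
  determinant.\<close>

lemma schur_stable_transpose: "schur_stable (transpose F) \<longleftrightarrow> schur_stable F"
proof -
  have "resolvent_matrix (transpose F) z = transpose (resolvent_matrix F z)" for z
    by (simp add: resolvent_matrix_def transpose_def vec_eq_iff)
  then show ?thesis by (simp add: schur_stable_iff_det)
qed

text \<open>Invertibility is an open condition and the closed unit disc is compact; the disc of radius greater
  than one is what makes the Taylor series of the inverse converge at \<open>1\<close>.\<close>

lemma schur_stable_resolvent_disc:
  assumes "schur_stable F"
  obtains r where "r > 1" and "\<And>z. z \<in> ball 0 r \<Longrightarrow> det (resolvent_matrix F z) \<noteq> 0"
proof -
  have "continuous_on UNIV (\<lambda>z. det (resolvent_matrix F z))"
    unfolding det_def resolvent_matrix_def by (auto intro!: continuous_intros)
  then have "open {z. det (resolvent_matrix F z) \<noteq> 0}"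
    using open_Collect_neq[OF _ continuous_on_const] by blast
  moreover have "cball 0 1 \<subseteq> {z. det (resolvent_matrix F z) \<noteq> 0}"
    using assms by (auto simp: schur_stable_iff_det)
  ultimately obtain e where "e > 0"
    and e: "(\<Union>x\<in>cball (0::complex) 1. ball x e) \<subseteq> {z. det (resolvent_matrix F z) \<noteq> 0}"
    using compact_subset_open_imp_ball_epsilon_subset[OF compact_cball] by metis
  show thesis
  proof
    show "1 + e > 1" using \<open>e > 0\<close> by simp
    fix z :: complex assume z: "z \<in> ball 0 (1 + e)"
    have "\<exists>x\<in>cball 0 1. z \<in> ball x e"
    proof (cases "cmod z \<le> 1")
      case True
      then show ?thesis using \<open>e > 0\<close> by (intro bexI[of _ z]) auto
    next
      case False
      \<comment> \<open>The radial projection of \<open>z\<close> to the unit circle has distance \<open>cmod z - 1 < e\<close> from \<open>z\<close>.\<close>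
      have "z \<noteq> 0" using False by (metis norm_zero zero_le_one)
      have "z /\<^sub>R cmod z - z = (1 / cmod z - 1) *\<^sub>R z"
        by (simp add: scaleR_diff_left divide_inverse)
      then have "dist (z /\<^sub>R cmod z) z = \<bar>1 / cmod z - 1\<bar> * cmod z"
        by (simp only: dist_norm norm_scaleR)
      also have "\<dots> = cmod z - 1"
        using False \<open>z \<noteq> 0\<close> by (simp add: abs_if field_simps)
      finally have "dist (z /\<^sub>R cmod z) z = cmod z - 1" .
      then show ?thesis using \<open>z \<noteq> 0\<close> z by (intro bexI[of _ "z /\<^sub>R cmod z"]) auto
    qed
    then show "det (resolvent_matrix F z) \<noteq> 0" using e by blast
  qed
qed

text \<open>By Cramer's rule the solution \<open>x z\<close> of \<open>(I - z F) x = b\<close> is holomorphic on a disc of radius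
  \<open>r > 1\<close>.  Comparing coefficients in \<open>x z = b + z F (x z)\<close> identifies its Taylor coefficients as the
  iterates \<open>F\<^sup>m b\<close>.  The Taylor series converges at \<open>z = 1\<close>, so its terms tend to \<open>0\<close>.\<close>

lemma schur_stable_powers_tendsto_0:
  fixes F :: "real^'n^'n"
  assumes "schur_stable F"
  shows "(\<lambda>k. ((*v) F ^^ k) b) \<longlonglongrightarrow> 0"
proof (rule vec_tendstoI)
  fix i :: 'n
  obtain r where r: "r > 1" and nz: "\<And>z. z \<in> ball 0 r \<Longrightarrow> det (resolvent_matrix F z) \<noteq> 0"
    using schur_stable_resolvent_disc[OF assms] by blast
  define x where "x z k = det (\<chi> i j. if j = k then complex_of_real (b $ i) else resolvent_matrix F z $ i $ j)
      / det (resolvent_matrix F z)" for z k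
  have holo: "(\<lambda>z. x z k) holomorphic_on ball 0 r" for k
  proof -
    have entry: "(\<lambda>z. resolvent_matrix F z $ i $ j) holomorphic_on ball 0 r" for i j
      unfolding resolvent_matrix_def by (auto intro!: holomorphic_intros)
    have "(\<lambda>z. (\<chi> i j. if j = k then complex_of_real (b $ i) else resolvent_matrix F z $ i $ j) $ i $ j)
        holomorphic_on ball 0 r" for i j
      using entry by (cases "j = k") auto
    then show ?thesis
      unfolding x_def using nz by (intro holomorphic_on_divide holomorphic_on_det entry)
  qed
  \<comment> \<open>The power series \<open>a k\<close> is the component \<open>k\<close> of the solution.\<close>
  define a where "a k = fps_expansion (\<lambda>z. x z k) 0" for k
  have a: "(\<lambda>z. x z k) has_fps_expansion a k" for k
    unfolding a_def by (rule has_fps_expansion_fps_expansion[OF _ _ holo]) (use r in auto)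
  have eq: "x z k = complex_of_real (b $ k) + z * (\<Sum>j\<in>UNIV. complex_of_real (F $ k $ j) * x z j)"
    if "z \<in> ball 0 r" for z k
  proof -
    have "resolvent_matrix F z *v (\<chi> k. x z k) = (\<chi> i. complex_of_real (b $ i))"
      by (simp add: cramer[OF nz[OF that]] x_def cong: if_cong)
    then have "(\<chi> k. x z k) - z *s (map_matrix complex_of_real F *v (\<chi> k. x z k)) = (\<chi> i. complex_of_real (b $ i))"
      by (simp add: resolvent_matrix_apply)
    then have "x z k - z * (\<Sum>j\<in>UNIV. complex_of_real (F $ k $ j) * x z j) = complex_of_real (b $ k)"
      by (simp add: vec_eq_iff matrix_vector_mult_def map_matrix_def)
    then show ?thesis by (simp add: algebra_simps)
  qed
  have a_eq: "a k = fps_const (complex_of_real (b $ k)) +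
      fps_X * (\<Sum>j\<in>UNIV. fps_const (complex_of_real (F $ k $ j)) * a j)" for k
  proof (rule fps_expansion_unique_complex[OF a])
    have expansion: "(\<lambda>z. complex_of_real (b $ k) + z * (\<Sum>j\<in>UNIV. complex_of_real (F $ k $ j) * x z j))
      has_fps_expansion fps_const (complex_of_real (b $ k)) +
      fps_X * (\<Sum>j\<in>UNIV. fps_const (complex_of_real (F $ k $ j)) * a j)"
      by (intro fps_expansion_intros a)
    have ev: "eventually (\<lambda>z. x z k = complex_of_real (b $ k) + z * (\<Sum>j\<in>UNIV. complex_of_real (F $ k $ j) * x z j)) (nhds 0)"
      using r by (intro eventually_nhds_in_open[of "ball 0 r", THEN eventually_mono] eq) auto
    show "(\<lambda>z. x z k) has_fps_expansion fps_const (complex_of_real (b $ k)) +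
      fps_X * (\<Sum>j\<in>UNIV. fps_const (complex_of_real (F $ k $ j)) * a j)"
      using expansion by (simp only: has_fps_expansion_cong[OF ev refl])
  qed
  have coeff: "fps_nth (a k) m = complex_of_real ((((*v) F ^^ m) b) $ k)" for k m
  proof (induction m arbitrary: k)
    case 0
    show ?case by (subst a_eq) simp
  next
    case (Suc m)
    show ?case
      by (subst a_eq) (simp add: fps_sum_nth Suc matrix_vector_mul_component inner_vec_def)
  qed
  have "ereal r \<le> fps_conv_radius (a i)"
    unfolding a_def by (rule conv_radius_fps_expansion) (use holo r in auto)
  then have "ereal (norm (1::complex)) < fps_conv_radius (a i)"
    by (rule less_le_trans[rotated]) (use r in simp)
  then have "summable (\<lambda>m. fps_nth (a i) m * 1 ^ m)"
    by (rule summable_fps)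
  then have "(\<lambda>m. fps_nth (a i) m) \<longlonglongrightarrow> 0"
    using summable_LIMSEQ_zero by fastforce
  then have "(\<lambda>m. norm (fps_nth (a i) m)) \<longlonglongrightarrow> 0"
    by (rule tendsto_norm_zero)
  then show "(\<lambda>k. ((*v) F ^^ k) b $ i) \<longlonglongrightarrow> 0 $ i"
    by (simp add: coeff tendsto_rabs_zero_iff)
qed

section \<open>The covariance equation\<close>

lemma form_iterates_tendsto_0:
  fixes F M :: "real^'n^'n"
  assumes "schur_stable F"
  shows "(\<lambda>k. (((*v) (transpose F) ^^ k) u) \<bullet> (M *v (((*v) (transpose F) ^^ k) v))) \<longlonglongrightarrow> 0"
proof -
  have *: "(\<lambda>k. ((*v) (transpose F) ^^ k) b) \<longlonglongrightarrow> 0" for b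
    by (rule schur_stable_powers_tendsto_0) (simp add: schur_stable_transpose assms)
  have "(\<lambda>k. M *v (((*v) (transpose F) ^^ k) v)) \<longlonglongrightarrow> M *v 0"
    using bounded_linear.tendsto[OF matrix_vector_mul_bounded_linear *] .
  then have "(\<lambda>k. (((*v) (transpose F) ^^ k) u) \<bullet> (M *v (((*v) (transpose F) ^^ k) v)))
      \<longlonglongrightarrow> 0 \<bullet> (M *v 0)"
    by (intro tendsto_inner *)
  then show ?thesis by simp
qed

text \<open>A solution satisfies \<open>X = F\<^sup>k X (F\<^sup>T)\<^sup>k\<close> for every \<open>k\<close>, and the right-hand side tends to \<open>0\<close>.\<close>

lemma stein_homogeneous_solution:
  fixes F X :: "real^'n^'n"
  assumes "schur_stable F" and "X = F ** X ** transpose F"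
  shows "X = 0"
proof -
  let ?G = "(*v) (transpose F)"
  have "u \<bullet> (X *v v) = ((?G ^^ k) u) \<bullet> (X *v ((?G ^^ k) v))" for u v k
  proof (induction k)
    case (Suc k)
    also have "((?G ^^ k) u) \<bullet> (X *v ((?G ^^ k) v)) = ((?G ^^ k) u) \<bullet> ((F ** X ** transpose F) *v ((?G ^^ k) v))"
      using assms(2) by simp
    also have "\<dots> = ((?G ^^ Suc k) u) \<bullet> (X *v ((?G ^^ Suc k) v))"
      unfolding form_congruence by simp
    finally show ?case .
  qed simp
  then have "u \<bullet> (X *v v) = 0" for u v
    using form_iterates_tendsto_0[OF assms(1), of u X v] LIMSEQ_unique
    by (metis (no_types, lifting) LIMSEQ_const_iff ext)
  then have "u \<bullet> (X *v v) = u \<bullet> (0 *v v)" for u v by simp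
  then show ?thesis by (rule matrix_eq_inner)
qed

text \<open>The values of the form of \<open>D\<close> decrease along the iterates of \<open>F\<^sup>T\<close>, and their limit is \<open>0\<close>.\<close>

lemma stein_inequality_psd:
  fixes F D :: "real^'n^'n"
  assumes F: "schur_stable F" and sym: "transpose D = D" and psd: "psd (D - F ** D ** transpose F)"
  shows "psd D"
proof -
  let ?G = "(*v) (transpose F)"
  have "((?G ^^ k) v) \<bullet> (D *v ((?G ^^ k) v)) \<le> v \<bullet> (D *v v)" for v k
  proof (induction k)
    case (Suc k)
    let ?v = "(?G ^^ k) v"
    have "0 \<le> ?v \<bullet> ((D - F ** D ** transpose F) *v ?v)"
      using psd by (simp add: psd_def)
    then have "(?G ?v) \<bullet> (D *v (?G ?v)) \<le> ?v \<bullet> (D *v ?v)"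
      by (simp add: matrix_vector_mult_diff_rdistrib inner_diff_right form_congruence del: transpose_matrix_vector)
    with Suc show ?case by (simp del: transpose_matrix_vector)
  qed simp
  then have "0 \<le> v \<bullet> (D *v v)" for v
    using form_iterates_tendsto_0[OF F, of v D v] by (intro LIMSEQ_le_const2) auto
  then show ?thesis using sym by (simp add: psd_def)
qed

text \<open>The linear map \<open>X \<mapsto> X - F X F\<^sup>T\<close> on the finite-dimensional space of matrices is injective, hence
  bijective.\<close>

lemma stein_unique_solution:
  fixes F W :: "real^'n^'n"
  assumes F: "schur_stable F"
  shows "\<exists>!X. X - F ** X ** transpose F - W = 0"
proof -
  let ?L = "\<lambda>X. X - F ** X ** transpose F"
  have lin: "linear ?L"
    by (intro linearI)
      (simp_all add: matrix_add_ldistrib matrix_add_rdistrib scaleR_diff_right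
        scalar_matrix_assoc matrix_scalar_ac)
  have inj: "inj ?L"
    using stein_homogeneous_solution[OF F] by (subst linear_injective_0[OF lin]) auto
  have "surj ?L"
    using lin inj by (rule linear_inj_imp_surj)
  then obtain X0 where X0: "W = ?L X0" by (rule surjE)
  show ?thesis
  proof (rule ex1I[of _ X0])
    show "?L X0 - W = 0" by (simp add: X0)
    fix X assume "?L X - W = 0"
    then have "?L X = ?L X0" by (simp add: X0)
    then show "X = X0" by (rule injD[OF inj])
  qed
qed

text \<open>The transpose of a solution is a solution too, so uniqueness gives symmetry.\<close>

lemma stein_solution_psd:
  fixes F W X :: "real^'n^'n"
  assumes F: "schur_stable F" and W: "psd W" and X: "X - F ** X ** transpose F - W = 0"
  shows "psd X"
proof -
  have "transpose (X - F ** X ** transpose F - W) = 0"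
    unfolding X by (simp add: transpose_def vec_eq_iff)
  then have "transpose X - F ** transpose X ** transpose F - W = 0"
    using W by (simp add: transpose_diff psd_def matrix_transpose_mul matrix_mul_assoc)
  then have "transpose X = X" using stein_unique_solution[OF F] X by blast
  moreover have "X - F ** X ** transpose F = W" using X by simp
  ultimately show ?thesis using stein_inequality_psd[OF F] W by simp
qed

text \<open>If \<open>F\<^sup>T v = \<mu> v\<close>, the inequality evaluated at \<open>v\<close> reads
  \<open>\<bar>\<mu>\<bar>\<^sup>2 v\<^sup>* X v + v\<^sup>* W v \<le> v\<^sup>* X v\<close> with \<open>v\<^sup>* W v > 0\<close>, so \<open>\<bar>\<mu>\<bar> < 1\<close>.  Since the forms are
  real, the proof evaluates the inequality at the real and imaginary parts \<open>a\<close>, \<open>b\<close> of \<open>v\<close> and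
  adds the results.  The inequality controls \<open>F\<^sup>T\<close>, which is why the transpose enters.\<close>

lemma lyapunov_schur_stable:
  fixes F X W :: "real^'n^'n"
  assumes W: "posdef W" and X: "psd X" and le: "psd (X - W - F ** X ** transpose F)"
  shows "schur_stable F"
proof -
  have "schur_stable (transpose F)"
    unfolding schur_stable_def
  proof (intro ballI)
    fix \<mu> assume "\<mu> \<in> eigenvalues (transpose F)"
    then obtain v where v: "v \<noteq> 0" "map_matrix complex_of_real (transpose F) *v v = \<mu> *s v"
      by (auto simp: eigenvalues_def)
    define a b where "a = (\<chi> i. Re (v $ i))" and "b = (\<chi> i. Im (v $ i))"
    let ?G = "transpose F"
    have comp: "(\<Sum>j\<in>UNIV. complex_of_real (?G $ i $ j) * v $ j) = \<mu> * v $ i" for i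
      using v(2) by (simp add: vec_eq_iff matrix_vector_mult_def map_matrix_def)
    have Ga: "?G *v a = Re \<mu> *\<^sub>R a - Im \<mu> *\<^sub>R b"
    proof (rule vec_eq_iff[THEN iffD2, rule_format])
      fix i show "(?G *v a) $ i = (Re \<mu> *\<^sub>R a - Im \<mu> *\<^sub>R b) $ i"
        using arg_cong[OF comp[of i], of Re] unfolding matrix_vector_mult_def by (simp add: a_def b_def)
    qed
    have Gb: "?G *v b = Im \<mu> *\<^sub>R a + Re \<mu> *\<^sub>R b"
    proof (rule vec_eq_iff[THEN iffD2, rule_format])
      fix i show "(?G *v b) $ i = (Im \<mu> *\<^sub>R a + Re \<mu> *\<^sub>R b) $ i"
        using arg_cong[OF comp[of i], of Im] unfolding matrix_vector_mult_def by (simp add: a_def b_def)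
    qed
    let ?q = "\<lambda>M u. u \<bullet> (M *v u)"
    have ineq: "?q X (?G *v u) + ?q W u \<le> ?q X u" for u
    proof -
      have "0 \<le> ?q (X - W - F ** X ** transpose F) u" using le by (simp add: psd_def)
      then show ?thesis
        by (simp add: matrix_vector_mult_diff_rdistrib inner_diff_right form_congruence del: transpose_matrix_vector)
    qed
    have ab: "a \<bullet> (X *v b) = b \<bullet> (X *v a)"
      using X symmetric_inner[of X a b] by (simp add: psd_def inner_commute)
    have "?q X (?G *v a) + ?q X (?G *v b) = ((Re \<mu>)\<^sup>2 + (Im \<mu>)\<^sup>2) * (?q X a + ?q X b)"
      unfolding Ga Gb
      by (simp add: matrix_vector_mult_diff_distrib matrix_vector_right_distrib matrix_vector_mult_scaleR
        inner_diff_left inner_diff_right inner_add_left inner_add_right ab power2_eq_square algebra_simps)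
    then have q: "(cmod \<mu>)\<^sup>2 * (?q X a + ?q X b) + (?q W a + ?q W b) \<le> ?q X a + ?q X b"
      using ineq[of a] ineq[of b] by (simp add: cmod_power2)
    have "a \<noteq> 0 \<or> b \<noteq> 0"
      using v(1) by (auto simp: a_def b_def vec_eq_iff complex_eq_iff)
    moreover have "0 \<le> ?q W u" "u \<noteq> 0 \<Longrightarrow> 0 < ?q W u" for u
      using W posdef_imp_psd[OF W] by (auto simp: posdef_def psd_def)
    ultimately have "0 < ?q W a + ?q W b"
      by (metis add_nonneg_pos add_pos_nonneg)
    with q have lt: "(cmod \<mu>)\<^sup>2 * (?q X a + ?q X b) < 1 * (?q X a + ?q X b)" by simp
    have "0 \<le> ?q X a + ?q X b"
      using X by (simp add: psd_def)
    then have "(cmod \<mu>)\<^sup>2 < 1" using lt by (metis mult_right_mono not_less)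
    then show "cmod \<mu> < 1" by (simp add: power_less_one_iff abs_square_less_1)
  qed
  then show ?thesis by (simp add: schur_stable_transpose)
qed

section \<open>Block matrices and Schur complements\<close>

lemma block_matrix_form:
  fixes M11 :: "real^'p^'p" and M12 :: "real^'q^'p" and M21 :: "real^'p^'q" and M22 :: "real^'q^'q"
    and v :: "real^('p + 'q)"
  defines "p \<equiv> \<chi> i. v $ Inl i" and "q \<equiv> \<chi> i. v $ Inr i"
  shows "v \<bullet> (block_matrix M11 M12 M21 M22 *v v) =
    p \<bullet> (M11 *v p) + p \<bullet> (M12 *v q) + (q \<bullet> (M21 *v p) + q \<bullet> (M22 *v q))"
proof -
  have split: "(\<Sum>i\<in>UNIV. f i) = (\<Sum>a\<in>UNIV. f (Inl a)) + (\<Sum>b\<in>UNIV. f (Inr b))"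
    for f :: "'p + 'q \<Rightarrow> real"
    by (subst UNIV_Plus_UNIV[symmetric], subst sum.Plus) simp_all
  show ?thesis
    by (simp add: inner_vec_def matrix_vector_mult_def block_matrix_def split p_def q_def
        distrib_left sum.distrib)
qed

lemma block_matrix_symmetric:
  "transpose (block_matrix P N (transpose N) X) = block_matrix P N (transpose N) X
     \<longleftrightarrow> transpose P = P \<and> transpose X = X"
  (is "?l \<longleftrightarrow> ?r")
proof
  assume ?l
  then have eq: "transpose (block_matrix P N (transpose N) X) $ i $ j = block_matrix P N (transpose N) X $ i $ j"
    for i j by simp
  show ?r
    using eq[of "Inl _" "Inl _"] eq[of "Inr _" "Inr _"]
    by (simp add: transpose_def block_matrix_def vec_eq_iff)
next
  assume ?r
  then show ?l
    by (auto simp: transpose_def block_matrix_def vec_eq_iff split: sum.splits)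
qed

text \<open>Completing the square: at \<open>(p, q)\<close> the block form equals the form of \<open>P - L X L\<^sup>T\<close> at \<open>p\<close> plus the
  form of \<open>X\<close> at \<open>L\<^sup>T p + q\<close>.  Writing the off-diagonal block as \<open>L X\<close> avoids any inverse of \<open>X\<close>.\<close>

lemma psd_block_matrix_iff:
  fixes P :: "real^'p^'p" and X :: "real^'q^'q" and L :: "real^'q^'p"
  shows "psd (block_matrix P (L ** X) (transpose (L ** X)) X) \<longleftrightarrow>
    psd X \<and> psd (P - L ** X ** transpose L)"
    (is "psd ?B \<longleftrightarrow> _")
proof -
  have complete_square: "v \<bullet> (?B *v v) = p \<bullet> ((P - L ** X ** transpose L) *v p) +
      (transpose L *v p + q) \<bullet> (X *v (transpose L *v p + q))"
    if "transpose X = X" "p = (\<chi> i. v $ Inl i)" "q = (\<chi> i. v $ Inr i)" for v p q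
  proof -
    have 1: "p \<bullet> ((L ** X) *v q) = (transpose L *v p) \<bullet> (X *v q)"
      by (metis inner_transpose_mult matrix_vector_mul_assoc transpose_transpose)
    have 2: "q \<bullet> (transpose (L ** X) *v p) = (transpose L *v p) \<bullet> (X *v q)"
      using 1 by (metis inner_transpose_mult inner_commute)
    have 3: "q \<bullet> (X *v (transpose L *v p)) = (transpose L *v p) \<bullet> (X *v q)"
      using symmetric_inner[OF that(1)] by (metis inner_commute)
    show ?thesis
      unfolding block_matrix_form that(2,3)[symmetric] 1 2
      by (simp add: matrix_vector_mult_diff_rdistrib inner_diff_right form_congruence
          matrix_vector_right_distrib inner_add_left inner_add_right 3 del: transpose_matrix_vector)
  qed
  have sym: "transpose (P - L ** X ** transpose L) = P - L ** X ** transpose L \<longleftrightarrow> transpose P = P"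
    if "transpose X = X"
    using that by (simp add: transpose_diff matrix_transpose_mul matrix_mul_assoc)
  show ?thesis
  proof
    assume B: "psd ?B"
    then have symX: "transpose X = X" and symP: "transpose P = P"
      unfolding psd_def block_matrix_symmetric by auto
    let ?join = "\<lambda>p q. \<chi> i. case i of Inl a \<Rightarrow> p $ a | Inr b \<Rightarrow> q $ b"
    have nonneg: "0 \<le> p \<bullet> ((P - L ** X ** transpose L) *v p) +
      (transpose L *v p + q) \<bullet> (X *v (transpose L *v p + q))" for p q
    proof -
      have "p = (\<chi> i. ?join p q $ Inl i)" "q = (\<chi> i. ?join p q $ Inr i)"
        by (simp_all add: vec_eq_iff)
      note complete_square[OF symX this]
      moreover have "0 \<le> ?join p q \<bullet> (?B *v ?join p q)"
        using B unfolding psd_def by blast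
      ultimately show ?thesis by simp
    qed
    have "0 \<le> q \<bullet> (X *v q)" for q using nonneg[of 0 q] by simp
    moreover have "0 \<le> p \<bullet> ((P - L ** X ** transpose L) *v p)" for p
      \<comment> \<open>This \<open>q\<close> annihilates the square.\<close>
      using nonneg[of p "- (transpose L *v p)"] by simp
    ultimately show "psd X \<and> psd (P - L ** X ** transpose L)"
      using symX symP sym by (simp add: psd_def)
  next
    assume asm: "psd X \<and> psd (P - L ** X ** transpose L)"
    then show "psd ?B"
      using complete_square sym unfolding psd_def block_matrix_symmetric by auto
  qed
qed

section \<open>Stationary covariance and stationary cost\<close>

lemma schur_stable_closed_loop_iff:
  "schur_stable (closed_loop A B K) \<longleftrightarrow> strictly_stabilizing A B K"
  by (simp add: schur_stable_def strictly_stabilizing_def)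

lemma stationary_cov_solves:
  assumes "strictly_stabilizing A B K"
  shows "stationary_cov A B W K
      - closed_loop A B K ** stationary_cov A B W K ** transpose (closed_loop A B K) - W = 0"
proof -
  have "schur_stable (closed_loop A B K)"
    using assms by (simp add: schur_stable_closed_loop_iff)
  from theI'[OF stein_unique_solution[OF this]] show ?thesis
    unfolding stationary_cov_def .
qed

lemma psd_stationary_cov:
  assumes "strictly_stabilizing A B K" and "psd W"
  shows "psd (stationary_cov A B W K)"
  using stein_solution_psd[OF _ assms(2) stationary_cov_solves[OF assms(1)]] assms(1)
  by (simp add: schur_stable_closed_loop_iff)

text \<open>The stationary cost of the gain \<open>K\<close> when the state has covariance \<open>X\<close>.  The control part
  \<open>Tr (R K X K\<^sup>T)\<close> is written in the congruence form in which the auxiliary matrix \<open>P\<close> bounds it.\<close>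

definition gain_cost :: "real^'n^'n \<Rightarrow> real^'m^'m \<Rightarrow> real^'n^'n \<Rightarrow> real^'n^'m \<Rightarrow> real" where
  "gain_cost Q R X K =
     trace (Q ** X) + trace ((posdef_sqrt R ** K) ** X ** transpose (posdef_sqrt R ** K))"

lemma integrable_component_product:
  fixes x :: "'w \<Rightarrow> real^'n"
  assumes "second_order M x"
  shows "integrable M (\<lambda>\<omega>. x \<omega> $ i * x \<omega> $ j)"
proof (rule Bochner_Integration.integrable_bound)
  show "integrable M (\<lambda>\<omega>. (norm (x \<omega>))\<^sup>2)"
    using assms by (simp add: second_order_def)
  have [measurable]: "x \<in> borel_measurable M"
    using assms by (simp add: second_order_def)
  show "(\<lambda>\<omega>. x \<omega> $ i * x \<omega> $ j) \<in> borel_measurable M"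
    unfolding cart_eq_inner_axis by measurable
  have "\<bar>x \<omega> $ i\<bar> * \<bar>x \<omega> $ j\<bar> \<le> norm (x \<omega>) * norm (x \<omega>)" for \<omega>
    by (intro mult_mono component_le_norm_cart) auto
  then show "AE \<omega> in M. norm (x \<omega> $ i * x \<omega> $ j) \<le> norm ((norm (x \<omega>))\<^sup>2)"
    by (simp add: abs_mult power2_eq_square)
qed

lemma expectation_quadratic_form:
  fixes x :: "'w \<Rightarrow> real^'n" and N :: "real^'n^'n"
  assumes x: "second_order M x" and mean: "integral\<^sup>L M x = 0"
  shows "(\<integral>\<omega>. x \<omega> \<bullet> (N *v x \<omega>) \<partial>M) = trace (N ** covariance M x)"
proof -
  have "(\<integral>\<omega>. x \<omega> \<bullet> (N *v x \<omega>) \<partial>M) =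
      (\<integral>\<omega>. (\<Sum>i\<in>UNIV. \<Sum>j\<in>UNIV. N $ i $ j * (x \<omega> $ j * x \<omega> $ i)) \<partial>M)"
    by (simp add: inner_vec_def matrix_vector_mult_def sum_distrib_left mult_ac)
  also have "\<dots> = (\<Sum>i\<in>UNIV. \<Sum>j\<in>UNIV. N $ i $ j * (\<integral>\<omega>. x \<omega> $ j * x \<omega> $ i \<partial>M))"
    using integrable_component_product[OF x] by (simp add: integral_sum)
  also have "\<dots> = trace (N ** covariance M x)"
    by (simp add: trace_def matrix_matrix_mult_def covariance_def cross_moment_def mean)
  finally show ?thesis .
qed

lemma expected_cost_eq_gain_cost:
  fixes x :: "'w \<Rightarrow> real^'n" and K :: "real^'n^'m"
  assumes x: "stationary_state M A B W K x" and R: "posdef R"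
  shows "expected_cost M Q R x (\<lambda>\<omega>. K *v x \<omega>) = gain_cost Q R (stationary_cov A B W K) K"
proof -
  let ?X = "stationary_cov A B W K" and ?S = "posdef_sqrt R"
  have cov: "second_order M x" "integral\<^sup>L M x = 0" "covariance M x = ?X"
    using x by (simp_all add: stationary_state_def)
  have S: "?S ** ?S = R" "transpose ?S = ?S"
    using posdef_sqrt[OF R] by (auto simp: posdef_def)
  let ?L = "?S ** K"
  have "transpose ?L ** ?L = transpose K ** (?S ** ?S) ** K"
    by (simp only: matrix_transpose_mul S(2) matrix_mul_assoc)
  then have LL: "transpose K ** R ** K = transpose ?L ** ?L"
    by (simp only: S(1))
  have "(K *v v) \<bullet> (R *v (K *v v)) = v \<bullet> ((transpose K ** R ** K) *v v)" for v
    by (metis inner_transpose_mult matrix_vector_mul_assoc)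
  then have "expected_cost M Q R x (\<lambda>\<omega>. K *v x \<omega>)
      = (\<integral>\<omega>. x \<omega> \<bullet> ((Q + transpose K ** R ** K) *v x \<omega>) \<partial>M)"
    by (simp add: expected_cost_def matrix_vector_mult_add_rdistrib inner_add_right)
  also have "\<dots> = trace (Q ** ?X) + trace (transpose ?L ** ?L ** ?X)"
    using expectation_quadratic_form[OF cov(1,2)]
    by (simp add: cov(3) matrix_add_rdistrib trace_add LL)
  also have "trace (transpose ?L ** ?L ** ?X) = trace (?L ** ?X ** transpose ?L)"
    by (metis matrix_mul_assoc trace_mul_sym)
  finally show ?thesis by (simp add: gain_cost_def)
qed

section \<open>The semidefinite program as a relaxation\<close>

lemma sdp_feasible_iff:
  fixes A :: "real^'n^'n" and B :: "real^'m^'n" and K :: "real^'n^'m" and R :: "real^'m^'m"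
  defines "F \<equiv> closed_loop A B K" and "L \<equiv> posdef_sqrt R ** K"
  shows "sdp_feasible A B W R X (K ** X) P \<longleftrightarrow>
    psd X \<and> psd P \<and> psd (P - L ** X ** transpose L) \<and> psd (X - W - F ** X ** transpose F)"
proof -
  have "posdef_sqrt R ** (K ** X) = L ** X" and "A ** X + B ** (K ** X) = F ** X"
    by (simp_all add: L_def F_def closed_loop_def matrix_mul_assoc matrix_add_rdistrib)
  then show ?thesis
    unfolding sdp_feasible_def by (auto simp: psd_block_matrix_iff) (auto simp: psd_def)
qed

text \<open>Both Schur complements of this point vanish, so its objective value is exactly the cost of the
  gain; the optimal value of the program is therefore a lower bound for the LQR cost.\<close>

lemma stabilizing_gain_sdp_feasible:
  fixes K :: "real^'n^'m" and R :: "real^'m^'m"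
  assumes K: "strictly_stabilizing A B K" and W: "psd W"
  defines "X \<equiv> stationary_cov A B W K" and "L \<equiv> posdef_sqrt R ** K"
  shows "sdp_feasible A B W R X (K ** X) (L ** X ** transpose L)"
proof -
  have X: "psd X" unfolding X_def by (rule psd_stationary_cov[OF K W])
  moreover have "X - W - closed_loop A B K ** X ** transpose (closed_loop A B K) = 0"
    using stationary_cov_solves[OF K, of W] by (simp add: X_def algebra_simps)
  ultimately show ?thesis
    unfolding sdp_feasible_iff L_def by (simp add: psd_congruence psd_0)
qed

text \<open>The top left block \<open>X - W\<close> of a semidefinite block matrix is semidefinite.  This has to come before
  the Schur complement conditions, since only invertibility of \<open>X\<close> gives \<open>Y\<close> the form \<open>K X\<close>.\<close>

lemma sdp_feasible_posdef:
  assumes "sdp_feasible A B W R X Y P" and W: "posdef W"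
  shows "posdef X"
proof -
  let ?N = "A ** X + B ** Y"
  have B: "psd (block_matrix (X - W) ?N (transpose ?N) X)" and symX: "transpose X = X"
    using assms by (auto simp: sdp_feasible_def)
  have "0 \<le> p \<bullet> ((X - W) *v p)" for p
  proof -
    let ?v = "\<chi> i. case i of Inl a \<Rightarrow> p $ a | Inr b \<Rightarrow> 0"
    have proj: "(\<chi> i. ?v $ Inl i) = p" "(\<chi> i. ?v $ Inr i) = 0" by (simp_all add: vec_eq_iff)
    have "0 \<le> ?v \<bullet> (block_matrix (X - W) ?N (transpose ?N) X *v ?v)"
      using B unfolding psd_def by blast
    then show ?thesis unfolding block_matrix_form proj by simp
  qed
  moreover have "transpose (X - W) = X - W"
    using symX W by (simp add: transpose_diff posdef_def)
  ultimately have "psd (X - W)" by (simp add: psd_def)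
  then show ?thesis using W by (rule psd_dominates_posdef)
qed

section \<open>Tightness of the relaxation\<close>

theorem theorem13:
  fixes A :: "real^'n^'n" and B :: "real^'m^'n"
    and Q W X :: "real^'n^'n" and R P :: "real^'m^'m" and Y :: "real^'n^'m"
    and M :: "'w measure" and w :: "nat \<Rightarrow> 'w \<Rightarrow> real^'n"
  assumes "prob_space M"
    and "white_noise M w W"
    and "posdef W"
    and "posdef Q"
    and "posdef R"
    and "stabilizable A B"
    and "sdp_optimal A B W Q R X Y P"
  shows "optimal_unconstrained_gain M A B W Q R (Y ** matrix_inv X) \<and>
         X = stationary_cov A B W (Y ** matrix_inv X)"
proof -
  have W: "psd W" by (rule posdef_imp_psd) fact
  have feas: "sdp_feasible A B W R X Y P"
    and opt: "\<And>X' Y' P'. sdp_feasible A B W R X' Y' P' \<Longrightarrow>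
      trace (Q ** X) + trace P \<le> trace (Q ** X') + trace P'"
    using assms(7) by (auto simp: sdp_optimal_def is_arg_min_linorder)
  define K where "K = Y ** matrix_inv X"
  define F where "F = closed_loop A B K"
  define L where "L = posdef_sqrt R ** K"
  have X: "posdef X" using sdp_feasible_posdef[OF feas] assms(3) by blast
  have "Y = K ** X"
    by (simp add: K_def matrix_mul_assoc[symmetric] posdef_matrix_inv[OF X])
  with feas have psds: "psd (P - L ** X ** transpose L)" "psd (X - W - F ** X ** transpose F)"
    by (simp_all add: sdp_feasible_iff F_def L_def)
  have F: "schur_stable F"
    by (rule lyapunov_schur_stable[OF assms(3) posdef_imp_psd[OF X] psds(2)])
  then have K: "strictly_stabilizing A B K"
    by (simp add: F_def schur_stable_closed_loop_iff)
  have P: "gain_cost Q R X K \<le> trace (Q ** X) + trace P"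
    using trace_psd_nonneg[OF psds(1)] by (simp add: trace_sub gain_cost_def L_def)
  have lower: "trace (Q ** X) + trace P \<le> gain_cost Q R (stationary_cov A B W K') K'"
    if "strictly_stabilizing A B K'" for K'
    using opt[OF stabilizing_gain_sdp_feasible[OF that W]] by (simp add: gain_cost_def)

  \<comment> \<open>\<open>D\<close> is the slack of \<open>X\<close> over the stationary covariance of \<open>K\<close>; optimality makes it vanish.\<close>
  define X0 where "X0 = stationary_cov A B W K"
  define D where "D = X - X0"
  have X0: "X0 - F ** X0 ** transpose F - W = 0"
    using stationary_cov_solves[OF K] by (simp add: X0_def F_def)
  have "transpose D = D"
    using X psd_stationary_cov[OF K W] by (simp add: D_def X0_def transpose_diff posdef_def psd_def)
  moreover have "D - F ** D ** transpose F = X - W - F ** X ** transpose F"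
    using X0 by (simp add: D_def matrix_diff_ldistrib matrix_diff_rdistrib algebra_simps)
  ultimately have D: "psd D"
    using stein_inequality_psd[OF F] psds(2) by simp
  have "trace (Q ** D) + trace (L ** D ** transpose L) = gain_cost Q R X K - gain_cost Q R X0 K"
    by (simp add: D_def gain_cost_def L_def matrix_diff_ldistrib matrix_diff_rdistrib trace_sub)
  also have "\<dots> \<le> 0"
    using P lower[OF K] by (simp add: X0_def)
  finally have "trace (Q ** D) = 0"
    using trace_posdef_psd(1)[OF assms(4) D] trace_psd_nonneg[OF psd_congruence[OF D, of L]] by simp
  then have "D = 0" by (rule trace_posdef_psd(2)[OF assms(4) D])
  then have XX0: "X = stationary_cov A B W K" by (simp add: D_def X0_def)
  moreover have "optimal_unconstrained_gain M A B W Q R K"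
    unfolding optimal_unconstrained_gain_def
  proof (intro conjI allI impI K)
    fix K' x x'
    assume K': "strictly_stabilizing A B K'"
      and x: "stationary_state M A B W K x" and x': "stationary_state M A B W K' x'"
    show "expected_cost M Q R x (\<lambda>\<omega>. K *v x \<omega>) \<le> expected_cost M Q R x' (\<lambda>\<omega>. K' *v x' \<omega>)"
      unfolding expected_cost_eq_gain_cost[OF x assms(5)] expected_cost_eq_gain_cost[OF x' assms(5)]
      using P lower[OF K'] by (simp add: XX0[symmetric])
  qed
  ultimately show ?thesis by (simp add: K_def)
qed

end
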